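(* Let $n\ge 2$ be an integer and let $m=2n$ agents $1,\dots,m$ be arranged in a ring network, agent $i$ having initial value $x_i(0)\in\mathbb{R}$. Suppose that all agents synchronously apply the following algorithm: for $k=1,2,\dots,n$ and every $i\in\{1,\dots,2n\}$, $$x_i(k)=(1-\alpha_k)\,x_i(k-1)+\alpha_k\,x_{j}(k-1),\qquad j=\begin{cases}\mathrm{Post}(i), & i+k \text{ even},\\ \mathrm{Pre}(i), & i+k\text{ odd},\end{cases}$$ where $\alpha_k=\frac{k}{k+1}$ for $1\le k<n$ and $\alpha_n=\frac12$. Then, after $n$ iterations, the estimate of every agent equals the average of the initial values, i.e. $$x_i(n)=\frac{1}{2n}\sum_{j=1}^{2n}x_j(0)\qquad\text{for all } i=1,\dots,2n.$$
   Context: The ring network with $m=2n$ agents is the undirected cycle graph on vertex set $\{1,\dots,2n\}$ with edges $(i,i+1)$ for $1\le i\le 2n-1$ and $(1,2n)$. The successor and predecessor functions $\mathrm{Post},\mathrm{Pre}:\{1,\dots,2n\}\to\{1,\dots,2n\}$ are $\mathrm{Post}(i)=i+1$ for $1\le i\le 2n-1$ and $\mathrm{Post}(2n)=1$; $\mathrm{Pre}(1)=2n$ and $\mathrm{Pre}(i)=i-1$ for $2\le i\le 2n$. The real number $x_i(k)$ is agent $i$'s estimate of the average after iteration $k$. "Synchronously" means that all agents perform the update at iteration $k$ simultaneously, using the values from iteration $k-1$. At each iteration each agent communicates with exactly one neighbor (gossip constraint). *)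

theory Defs
  imports Complex_Main
begin

text \<open>
  The agents are \<open>{1..2 * n}\<close>; the functions below are only meaningful for arguments in that set.
\<close>

definition ring_edges :: "nat \<Rightarrow> nat set set" where
  "ring_edges n = {{i, i + 1} | i. 1 \<le> i \<and> i \<le> 2 * n - 1} \<union> {{1, 2 * n}}"

definition Post :: "nat \<Rightarrow> nat \<Rightarrow> nat" where
  "Post n i = (if i = 2 * n then 1 else i + 1)"

definition Pre :: "nat \<Rightarrow> nat \<Rightarrow> nat" where
  "Pre n i = (if i = 1 then 2 * n else i - 1)"

definition partner :: "nat \<Rightarrow> nat \<Rightarrow> nat \<Rightarrow> nat" where
  "partner n k i = (if even (i + k) then Post n i else Pre n i)"

definition gossip_weight :: "nat \<Rightarrow> nat \<Rightarrow> real" where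
  "gossip_weight n k = (if k < n then real k / real (k + 1) else 1 / 2)"

text \<open>
  Here \<open>x i k\<close> is the estimate of agent \<open>i\<close> after iteration \<open>k\<close>. Nothing is
  required of \<open>x\<close> outside the agents \<open>{1..2 * n}\<close> and the iterations \<open>{0..n}\<close>.
\<close>

definition ring_gossip_run :: "nat \<Rightarrow> (nat \<Rightarrow> nat \<Rightarrow> real) \<Rightarrow> bool" where
  "ring_gossip_run n x \<longleftrightarrow>
    (\<forall>k\<in>{1..n}. \<forall>i\<in>{1..2 * n}.
      x i k = (1 - gossip_weight n k) * x i (k - 1)
              + gossip_weight n k * x (partner n k i) (k - 1))"

text \<open>
  At each iteration the communicating pairs form a perfect matching of the ring, so every agent
  communicates with exactly one neighbour.
\<close>

lemma partner_in_agents: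
  assumes "i \<in> {1..2 * n}"
  shows "partner n k i \<in> {1..2 * n}"
  using assms by (auto simp: partner_def Post_def Pre_def)

lemma partner_adjacent:
  assumes "i \<in> {1..2 * n}"
  shows "{i, partner n k i} \<in> ring_edges n"
proof -
  have *: "{j, j + 1} \<in> ring_edges n" if "1 \<le> j" "j \<le> 2 * n - 1" for j
    using that unfolding ring_edges_def by blast
  have w: "{1, 2 * n} \<in> ring_edges n"
    by (simp add: ring_edges_def)
  have post: "{i, Post n i} \<in> ring_edges n"
    using assms *[of i] w by (auto simp: Post_def insert_commute)
  have pre: "{i, Pre n i} \<in> ring_edges n"
    using assms *[of "i - 1"] w by (auto simp: Pre_def insert_commute)
  show ?thesis
    using post pre by (simp add: partner_def)
qed

lemma partner_involutive:
  assumes "i \<in> {1..2 * n}"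
  shows "partner n k (partner n k i) = i"
  using assms by (auto simp: partner_def Post_def Pre_def; presburger)

end

theory Submission
  imports Defs
begin

text \<open>
  Unroll the ring to a \<open>2n\<close>-periodic sequence indexed by the integers, and put
  \<open>S j = y 0 j + y 0 (j + 1)\<close>. For \<open>1 \<le> k < n\<close> the estimate \<open>y k i\<close> is a convex
  combination of the \<open>k\<close> consecutive disjoint pair sums around \<open>i\<close>, with weights proportional
  to \<open>1, 2, \<dots>, k\<close> if \<open>i + k\<close> is even and to \<open>k, \<dots>, 2, 1\<close> if it is odd: \<open>\<alpha>\<^sub>k = k / (k + 1)\<close> is
  exactly the value that preserves this triangular shape. In the last iteration an increasing
  and a decreasing profile, offset by one pair, are averaged; they add up to a constant profile
  over \<open>n\<close> pairs, that is, over one full period.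
\<close>

section \<open>Triangular weight profiles on the integer line\<close>

text \<open>The added term has weight zero. Together with the next lemma this puts two profiles
  offset by one pair over the same \<open>k + 1\<close> pairs.\<close>

lemma sum_decreasing_weights_Suc:
  fixes c :: "nat \<Rightarrow> real"
  shows "(\<Sum>p<k. (real k - real p) * c p) = (\<Sum>p<Suc k. (real k - real p) * c p)"
  by simp

lemma sum_increasing_weights_Suc:
  fixes c :: "nat \<Rightarrow> real"
  shows "(\<Sum>p<k. (real p + 1) * c (Suc p)) = (\<Sum>p<Suc k. real p * c p)"
  by (simp add: sum.lessThan_Suc_shift add.commute del: sum.lessThan_Suc)

definition pair_sum :: "(int \<Rightarrow> real) \<Rightarrow> int \<Rightarrow> real" where
  "pair_sum f j = f j + f (j + 1)"

definition line_partner :: "nat \<Rightarrow> int \<Rightarrow> int" where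
  "line_partner k i = (if even (i + int k) then i + 1 else i - 1)"

text \<open>Both parities need one joint induction: of \<open>i\<close> and its partner, one carries
  the increasing and the other the decreasing profile of the previous iteration, on windows offset
  by one pair. The factor \<open>real k * real (k + 1)\<close> is twice the sum of the weights, as
  each pair sum holds two values.\<close>

lemma line_gossip_profile:
  fixes y :: "nat \<Rightarrow> int \<Rightarrow> real"
  assumes step: "\<And>k i. \<lbrakk>1 \<le> k; k < n\<rbrakk> \<Longrightarrow>
      real (k + 1) * y k i = y (k - 1) i + real k * y (k - 1) (line_partner k i)"
    and "1 \<le> k" "k < n"
  shows "even (i + int k) \<Longrightarrow>
      real k * real (k + 1) * y k i
        = (\<Sum>p<k. (real p + 1) * pair_sum (y 0) (i - int k + 1 + 2 * int p))"
    and "odd (i + int k) \<Longrightarrow>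
      real k * real (k + 1) * y k i
        = (\<Sum>p<k. (real k - real p) * pair_sum (y 0) (i - int k + 2 * int p))"
  using assms(2,3)
proof (induction k arbitrary: i rule: dec_induct)
  case base
  {
    case 1
    then show ?case using step[of 1 i] by (simp add: line_partner_def pair_sum_def)
  next
    case 2
    then show ?case using step[of 1 i] by (simp add: line_partner_def pair_sum_def)
  }
next
  case (step k)
  {
    case 1
    have k: "real k > 0" "k < n" using step.hyps 1 by auto
    define c where "c p = pair_sum (y 0) (i - int k + 2 * int p)" for p
    have "real k * real (k + 1) * y k i = (\<Sum>p<k. (real k - real p) * c p)"
      using step.IH(2)[of i] k 1 by (simp add: c_def)
    moreover have "real k * real (k + 1) * y k (i + 1) = (\<Sum>p<k. (real p + 1) * c (Suc p))"
      using step.IH(1)[of "i + 1"] k 1 by (simp add: c_def algebra_simps)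
    moreover have "real (k + 2) * y (Suc k) i = y k i + real (k + 1) * y k (i + 1)"
      using assms(1)[of "Suc k" i] 1 by (simp add: line_partner_def algebra_simps)
    ultimately have "real k * (real (k + 1) * real (k + 2) * y (Suc k) i)
        = (\<Sum>p<Suc k. (real k - real p) * c p) + real (k + 1) * (\<Sum>p<Suc k. real p * c p)"
      unfolding sum_decreasing_weights_Suc sum_increasing_weights_Suc
      by (smt (verit) distrib_left mult.assoc mult.commute)
    \<comment> \<open>Termwise \<open>(k - p) + (k + 1) * p = k * (p + 1)\<close>; the common factor
      \<open>k\<close> is then cancelled.\<close>
    also have "\<dots> = real k * (\<Sum>p<Suc k. (real p + 1) * c p)"
      unfolding sum_distrib_left sum.distrib[symmetric]
      by (rule sum.cong) (auto simp: algebra_simps)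
    finally have "real (k + 1) * real (k + 2) * y (Suc k) i = (\<Sum>p<Suc k. (real p + 1) * c p)"
      using k(1) by (metis mult_left_cancel less_irrefl)
    then show ?case by (simp add: c_def algebra_simps)
  next
    case 2
    have k: "real k > 0" "k < n" using step.hyps 2 by auto
    define c where "c p = pair_sum (y 0) (i - 1 - int k + 2 * int p)" for p
    have "real k * real (k + 1) * y k (i - 1) = (\<Sum>p<k. (real k - real p) * c p)"
      using step.IH(2)[of "i - 1"] k 2 by (simp add: c_def)
    moreover have "real k * real (k + 1) * y k i = (\<Sum>p<k. (real p + 1) * c (Suc p))"
      using step.IH(1)[of i] k 2 by (simp add: c_def algebra_simps)
    moreover have "real (k + 2) * y (Suc k) i = y k i + real (k + 1) * y k (i - 1)"
      using assms(1)[of "Suc k" i] 2 by (simp add: line_partner_def algebra_simps)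
    ultimately have "real k * (real (k + 1) * real (k + 2) * y (Suc k) i)
        = (\<Sum>p<Suc k. real p * c p) + real (k + 1) * (\<Sum>p<Suc k. (real k - real p) * c p)"
      unfolding sum_decreasing_weights_Suc sum_increasing_weights_Suc
      by (smt (verit) distrib_left mult.assoc mult.commute)
    \<comment> \<open>The mirror image:
      \<open>p + (k + 1) * (k - p) = k * (k + 1 - p)\<close>.\<close>
    also have "\<dots> = real k * (\<Sum>p<Suc k. (real (Suc k) - real p) * c p)"
      unfolding sum_distrib_left sum.distrib[symmetric]
      by (rule sum.cong) (auto simp: algebra_simps)
    finally have "real (k + 1) * real (k + 2) * y (Suc k) i = (\<Sum>p<Suc k. (real (Suc k) - real p) * c p)"
      using k(1) by (metis mult_left_cancel less_irrefl)
    then show ?case by (simp add: c_def algebra_simps)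
  }
qed

text \<open>Under equal weights the two profiles of iteration \<open>n - 1\<close> add up to a
  constant: \<open>(m - p) + p = m\<close> with \<open>m = n - 1\<close>. The start \<open>a\<close>
  of the window varies with \<open>i\<close>; periodicity will make it immaterial.\<close>

lemma line_gossip_final:
  fixes y :: "nat \<Rightarrow> int \<Rightarrow> real"
  assumes step: "\<And>k i. \<lbrakk>1 \<le> k; k < n\<rbrakk> \<Longrightarrow>
      real (k + 1) * y k i = y (k - 1) i + real k * y (k - 1) (line_partner k i)"
    and last: "\<And>i. 2 * y n i = y (n - 1) i + y (n - 1) (line_partner n i)"
    and "n \<ge> 2"
  shows "\<exists>a. real (2 * n) * y n i = (\<Sum>p<n. pair_sum (y 0) (a + 2 * int p))"
proof -
  obtain m where m: "n = Suc m" "1 \<le> m" "m < n"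
    using \<open>n \<ge> 2\<close> by (cases n) auto
  have even_case: "real (2 * n) * y n i = (\<Sum>p<n. pair_sum (y 0) (i - int m + 2 * int p))"
    if "even (i + int n)" for i
  proof -
    define c where "c p = pair_sum (y 0) (i - int m + 2 * int p)" for p
    have "real m * real (m + 1) * y m i = (\<Sum>p<m. (real m - real p) * c p)"
      using line_gossip_profile(2)[OF step m(2,3), of i] that m(1) by (simp add: c_def)
    moreover have "real m * real (m + 1) * y m (i + 1) = (\<Sum>p<m. (real p + 1) * c (Suc p))"
      using line_gossip_profile(1)[OF step m(2,3), of "i + 1"] that m(1)
      by (simp add: c_def algebra_simps)
    moreover have "2 * y n i = y m i + y m (i + 1)"
      using last[of i] that m(1) by (simp add: line_partner_def)
    ultimately have "real m * (real (2 * n) * y n i)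
        = (\<Sum>p<n. (real m - real p) * c p) + (\<Sum>p<n. real p * c p)"
      unfolding sum_decreasing_weights_Suc sum_increasing_weights_Suc m(1)
      by (simp add: algebra_simps)
    also have "\<dots> = real m * (\<Sum>p<n. c p)"
      unfolding sum_distrib_left sum.distrib[symmetric]
      by (rule sum.cong) (auto simp: algebra_simps)
    finally show ?thesis using m(2) by (simp add: c_def)
  qed
  show ?thesis
  proof (cases "even (i + int n)")
    case True
    then show ?thesis using even_case by blast
  next
    case False
    \<comment> \<open>Here \<open>i\<close> and \<open>i - 1\<close> are partners, and averaging
      with weight 1/2 leaves both with the same value.\<close>
    then have "y n i = y n (i - 1)"
      using last[of i] last[of "i - 1"] by (simp add: line_partner_def)
    then show ?thesis using even_case[of "i - 1"] False by auto
  qed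
qed

section \<open>Sums over one period\<close>

lemma sum_pair_sum:
  "(\<Sum>p<n. pair_sum f (a + 2 * int p)) = (\<Sum>j<2 * n. f (a + int j))"
  by (induction n) (simp_all add: pair_sum_def algebra_simps)

text \<open>Moving the window by one drops \<open>f i\<close> and gains
  \<open>f (i + int N)\<close>, which are equal; induction in both directions from \<open>b\<close>
  reaches every \<open>a\<close>.\<close>

lemma sum_period_shift:
  fixes f :: "int \<Rightarrow> real"
  assumes periodic: "\<And>i. f (i + int N) = f i"
  shows "(\<Sum>j<N. f (a + int j)) = (\<Sum>j<N. f (b + int j))"
proof -
  have shift: "(\<Sum>j<N. f (i + 1 + int j)) = (\<Sum>j<N. f (i + int j))" for i
  proof -
    have "f i + (\<Sum>j<N. f (i + 1 + int j)) = (\<Sum>j<Suc N. f (i + int j))"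
      by (simp add: sum.lessThan_Suc_shift algebra_simps del: sum.lessThan_Suc)
    then show ?thesis using periodic[of i] by simp
  qed
  show ?thesis
  proof (induction a rule: int_induct[where k = b])
    case (step1 i)
    then show ?case using shift[of i] by simp
  next
    case (step2 i)
    then show ?case using shift[of "i - 1"] by simp
  qed simp
qed

section \<open>Unrolling the ring\<close>

text \<open>Shifting by one before and after \<open>mod\<close> selects representatives in
  \<open>{1..2 * n}\<close>, since agents are numbered from 1.\<close>

definition unroll :: "nat \<Rightarrow> (nat \<Rightarrow> 'a) \<Rightarrow> int \<Rightarrow> 'a" where
  "unroll n f i = f (nat ((i - 1) mod int (2 * n)) + 1)"

lemma unroll_agent:
  assumes "i \<in> {1..2 * n}"
  shows "unroll n f (int i) = f i"
proof -
  have "(int i - 1) mod int (2 * n) = int i - 1"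
    using assms by (intro mod_pos_pos_trivial) auto
  moreover have "Suc (nat (int i - 1)) = i" using assms by auto
  ultimately show ?thesis by (simp add: unroll_def)
qed

lemma unroll_periodic: "unroll n f (i + int (2 * n)) = unroll n f i"
proof -
  have "i + int (2 * n) - 1 = (i - 1) + int (2 * n)" by simp
  then show ?thesis unfolding unroll_def by (simp only: mod_add_self2)
qed

text \<open>The ring has even length, so reduction modulo \<open>2 * n\<close> preserves parity and
  the alternation of \<open>Post\<close> and \<open>Pre\<close> lifts consistently to the
  line.\<close>

lemma unroll_line_partner:
  fixes i :: int
  assumes "n \<ge> 1"
  defines "r \<equiv> nat ((i - 1) mod int (2 * n)) + 1"
  shows "unroll n f (line_partner k i) = f (partner n k r)" and "r \<in> {1..2 * n}"
proof -
  define N where "N = int (2 * n)"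
  define q where "q = (i - 1) div N"
  have N: "N > 0" "even N" using assms by (auto simp: N_def)
  have r_int: "int r = (i - 1) mod N + 1" using N by (simp add: r_def N_def)
  then have i: "i = int r + q * N"
    using div_mult_mod_eq[of "i - 1" N] by (simp add: q_def)
  have "(i - 1) mod N < N" "(i - 1) mod N \<ge> 0" using N by simp_all
  then show r: "r \<in> {1..2 * n}" using r_int by (auto simp: N_def)
  have par: "even (i + int k) \<longleftrightarrow> even (r + k)"
    using N i by simp
  have at: "unroll n f (int r + d + q * N) = f (nat ((int r + d - 1) mod N) + 1)" for d
  proof -
    have "int r + d + q * N - 1 = (int r + d - 1) + q * N" by simp
    then show ?thesis unfolding unroll_def N_def[symmetric] by (simp only: mod_mult_self1)
  qed
  have post: "nat ((int r + 1 - 1) mod N) + 1 = Post n r"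
  proof (cases "r = 2 * n")
    case True
    then show ?thesis by (simp add: N_def Post_def)
  next
    case False
    then have "int r mod N = int r" using r by (intro mod_pos_pos_trivial) (auto simp: N_def)
    then show ?thesis using False by (simp add: Post_def)
  qed
  \<comment> \<open>The wrap-around at \<open>r = 1\<close> comes from
    \<open>- 1 mod N = N - 1\<close>.\<close>
  have pre: "nat ((int r + (- 1) - 1) mod N) + 1 = Pre n r"
  proof (cases "r = 1")
    case True
    then show ?thesis using N by (simp add: N_def Pre_def zmod_minus1)
  next
    case False
    then have "(int r - 2) mod N = int r - 2"
      using r by (intro mod_pos_pos_trivial) (auto simp: N_def)
    then show ?thesis using False r by (auto simp: Pre_def)
  qed
  show "unroll n f (line_partner k i) = f (partner n k r)"
  proof (cases "even (i + int k)")
    case True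
    then have "line_partner k i = int r + 1 + q * N" using i by (simp add: line_partner_def)
    then show ?thesis using at[of 1] post True par by (simp add: partner_def)
  next
    case False
    then have "line_partner k i = int r + (- 1) + q * N" using i by (simp add: line_partner_def)
    then show ?thesis using at[of "- 1"] pre False par by (simp add: partner_def)
  qed
qed

text \<open>Reducing \<open>i\<close> to its agent \<open>r\<close> turns the update rule on the
  ring into a recurrence at every integer, without boundary cases.\<close>

lemma unroll_ring_gossip_run:
  fixes i :: int
  assumes "ring_gossip_run n x" "n \<ge> 1" "k \<in> {1..n}"
  defines "y \<equiv> \<lambda>k. unroll n (\<lambda>j. x j k)"
  shows "y k i = (1 - gossip_weight n k) * y (k - 1) i
                 + gossip_weight n k * y (k - 1) (line_partner k i)"
proof -
  define r where "r = nat ((i - 1) mod int (2 * n)) + 1"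
  have "r \<in> {1..2 * n}"
    unfolding r_def by (rule unroll_line_partner(2)[OF assms(2)])
  then have "x r k = (1 - gossip_weight n k) * x r (k - 1)
      + gossip_weight n k * x (partner n k r) (k - 1)"
    using assms(1,3) unfolding ring_gossip_run_def by blast
  moreover have "y (k - 1) (line_partner k i) = x (partner n k r) (k - 1)"
    unfolding y_def r_def by (rule unroll_line_partner(1)[OF assms(2)])
  moreover have "y l i = x r l" for l
    by (simp add: y_def r_def unroll_def)
  ultimately show ?thesis by simp
qed

theorem theorem1:
  fixes n :: nat and x :: "nat \<Rightarrow> nat \<Rightarrow> real"
  assumes "n \<ge> 2"
    and "ring_gossip_run n x"
  shows "\<forall>i\<in>{1..2 * n}. x i n = (1 / real (2 * n)) * (\<Sum>j = 1..2 * n. x j 0)"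
proof
  fix i assume i: "i \<in> {1..2 * n}"
  define y where "y = (\<lambda>k. unroll n (\<lambda>i. x i k))"
  have n: "n \<ge> 1" using assms(1) by simp
  have run: "y k j = (1 - gossip_weight n k) * y (k - 1) j
                 + gossip_weight n k * y (k - 1) (line_partner k j)" if "k \<in> {1..n}" for k j
    unfolding y_def by (rule unroll_ring_gossip_run[OF assms(2) n that])
  have step: "real (k + 1) * y k j = y (k - 1) j + real k * y (k - 1) (line_partner k j)"
    if "1 \<le> k" "k < n" for k j
  proof -
    have w: "gossip_weight n k = real k / real (k + 1)"
      and w': "1 - real k / real (k + 1) = 1 / real (k + 1)"
      using that by (simp_all add: gossip_weight_def field_simps)
    have "y k j = 1 / real (k + 1) * y (k - 1) j
        + real k / real (k + 1) * y (k - 1) (line_partner k j)"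
      using run[of k j] that unfolding w w' by simp
    then show ?thesis by (simp add: field_simps del: of_nat_Suc)
  qed
  have last: "2 * y n j = y (n - 1) j + y (n - 1) (line_partner n j)" for j
    using run[of n j] n by (simp add: gossip_weight_def)
  obtain a where "real (2 * n) * y n (int i) = (\<Sum>p<n. pair_sum (y 0) (a + 2 * int p))"
    using line_gossip_final[OF step last assms(1)] by blast
  \<comment> \<open>The pairs tile a full period, which may be moved to start at agent 1.\<close>
  also have "\<dots> = (\<Sum>j<2 * n. y 0 (1 + int j))"
    unfolding sum_pair_sum by (rule sum_period_shift) (simp only: y_def unroll_periodic)
  also have "\<dots> = (\<Sum>j<2 * n. x (Suc j) 0)"
  proof (rule sum.cong)
    fix j assume "j \<in> {..<2 * n}"
    then show "y 0 (1 + int j) = x (Suc j) 0"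
      using unroll_agent[of "Suc j" n "\<lambda>i. x i 0"] by (simp add: y_def)
  qed simp
  also have "\<dots> = (\<Sum>j = 1..2 * n. x j 0)"
    by (rule sum.reindex_bij_witness[where i = "\<lambda>j. j - 1" and j = Suc]) auto
  finally have "real (2 * n) * x i n = (\<Sum>j = 1..2 * n. x j 0)"
    using unroll_agent[OF i, of "\<lambda>i. x i n"] by (simp add: y_def)
  then show "x i n = (1 / real (2 * n)) * (\<Sum>j = 1..2 * n. x j 0)"
    using n by (simp add: field_simps)
qed

end
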